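(* Let $\Psi$ be an unsatisfiable $(2,k)$-CSP with variable frequency at most $r$ on $m$ variables. If $r$ is fixed and $k \in o(\sqrt m)$, then there exists a tree-like resolution refutation of the CNF representation of $\Psi$ of size $2^{(1-\epsilon_r)m + o(m)}$, where $\epsilon_r = (1 - 2^{-1/r})^r$.
   Context: A $(2,k)$-CSP $\Psi = (X,\mathcal{C})$ consists of a finite set $X$ of Boolean variables and a finite set $\mathcal{C}$ of constraints, each on at most $k$ of the variables. An assignment satisfies $\Psi$ if it satisfies every constraint. The variable frequency of $\Psi$ is the largest number of constraints that any variable appears in. The CNF representation of $\Psi$ is the $k$-CNF obtained by writing each constraint as a CNF over its own variables: for each assignment to the variables of the constraint that violates it, there is the clause on these variables falsified exactly by that assignment (so a $(2,k)$-CSP with $n$ constraints gives at most $n2^k$ clauses). A tree-like resolution refutation is a resolution refutation whose underlying derivation graph is a tree. Its smallest size equals the smallest size of a decision tree for the CNF, i.e. a rooted binary tree whose inner nodes are labeled by variables, whose edges are labeled by $0/1$ (the value of the variable queried at the node they come out of), and whose leaves are labeled by clauses falsified by the partial assignment along the path from the root to the leaf. Asymptotic notation is as $m\to\infty$ with $r$ fixed and $k = k(m) = o(\sqrt m)$; the $o(m)$ term depends on $r$ and on the function $k(m)$, but not on the particular $\Psi$. *)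

theory Defs
  imports Complex_Main "HOL-Library.Landau_Symbols"
begin

section \<open>Boolean constraint satisfaction problems\<close>

text \<open>A constraint is given by its scope and by the set of those assignments to the scope that
  satisfy it. An assignment to a set \<open>V\<close> of Boolean variables is a map with domain \<open>V\<close>.\<close>

type_synonym 'a assignment = "'a \<rightharpoonup> bool"

type_synonym 'a constraint = "'a set \<times> 'a assignment set"

abbreviation scope :: "'a constraint \<Rightarrow> 'a set" where
  "scope \<equiv> fst"

abbreviation allowed :: "'a constraint \<Rightarrow> 'a assignment set" where
  "allowed \<equiv> snd"

record 'a csp =
  vars :: "'a set"
  constraints :: "'a constraint set"

text \<open>The last conjunct makes the representation of a constraint canonical, so that the same
  constraint cannot occur twice in the set of constraints.\<close>

definition is_2k_csp :: "nat \<Rightarrow> 'a csp \<Rightarrow> bool" where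
  "is_2k_csp k \<Psi> \<longleftrightarrow>
     finite (vars \<Psi>) \<and> finite (constraints \<Psi>) \<and>
     (\<forall>c\<in>constraints \<Psi>.
        scope c \<subseteq> vars \<Psi> \<and> card (scope c) \<le> k \<and> (\<forall>\<sigma>\<in>allowed c. dom \<sigma> = scope c))"

definition satisfies_constraint :: "'a assignment \<Rightarrow> 'a constraint \<Rightarrow> bool" where
  "satisfies_constraint \<tau> c \<longleftrightarrow> \<tau> |` scope c \<in> allowed c"

definition csp_satisfiable :: "'a csp \<Rightarrow> bool" where
  "csp_satisfiable \<Psi> \<longleftrightarrow>
     (\<exists>\<tau>. dom \<tau> = vars \<Psi> \<and> (\<forall>c\<in>constraints \<Psi>. satisfies_constraint \<tau> c))"

text \<open>The inserted \<open>0\<close> gives \<open>Max\<close> a meaningful value if there are no variables.\<close>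

definition var_frequency :: "'a csp \<Rightarrow> nat" where
  "var_frequency \<Psi> =
     Max (insert 0 ((\<lambda>x. card {c \<in> constraints \<Psi>. x \<in> scope c}) ` vars \<Psi>))"


section \<open>Clauses and the CNF representation\<close>

datatype 'a literal = Pos 'a | Neg 'a

type_synonym 'a clause = "'a literal set"

text \<open>The clause on the variables in \<open>dom \<sigma>\<close> that is falsified exactly by \<open>\<sigma>\<close>.\<close>

definition falsified_clause :: "'a assignment \<Rightarrow> 'a clause" where
  "falsified_clause \<sigma> = {Neg x | x. \<sigma> x = Some True} \<union> {Pos x | x. \<sigma> x = Some False}"

definition constraint_cnf :: "'a constraint \<Rightarrow> 'a clause set" where
  "constraint_cnf c = {falsified_clause \<sigma> | \<sigma>. dom \<sigma> = scope c \<and> \<sigma> \<notin> allowed c}"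

definition cnf_representation :: "'a csp \<Rightarrow> 'a clause set" where
  "cnf_representation \<Psi> = (\<Union>c\<in>constraints \<Psi>. constraint_cnf c)"


section \<open>Tree-like resolution\<close>

text \<open>\<open>Resolve x s t\<close> resolves the clauses derived by \<open>s\<close> and \<open>t\<close> on the variable \<open>x\<close>, which has
  to occur positively in the former and negatively in the latter. There is no weakening rule.\<close>

datatype 'a res_tree = Axiom "'a clause" | Resolve 'a "'a res_tree" "'a res_tree"

primrec conclusion :: "'a res_tree \<Rightarrow> 'a clause" where
  "conclusion (Axiom C) = C"
| "conclusion (Resolve x s t) = (conclusion s - {Pos x}) \<union> (conclusion t - {Neg x})"

primrec derivation_from :: "'a clause set \<Rightarrow> 'a res_tree \<Rightarrow> bool" where
  "derivation_from F (Axiom C) \<longleftrightarrow> C \<in> F"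
| "derivation_from F (Resolve x s t) \<longleftrightarrow>
     derivation_from F s \<and> derivation_from F t \<and> Pos x \<in> conclusion s \<and> Neg x \<in> conclusion t"

definition tree_refutation :: "'a clause set \<Rightarrow> 'a res_tree \<Rightarrow> bool" where
  "tree_refutation F t \<longleftrightarrow> derivation_from F t \<and> conclusion t = {}"

text \<open>The number of nodes of the tree, axioms included.\<close>

primrec refutation_size :: "'a res_tree \<Rightarrow> nat" where
  "refutation_size (Axiom C) = 1"
| "refutation_size (Resolve x s t) = 1 + refutation_size s + refutation_size t"


definition savings :: "nat \<Rightarrow> real" where
  "savings r = (1 - 2 powr (- 1 / real r)) ^ r"

end

theory Submission
  imports Defs
begin

text \<open>Put each constraint into \<open>A\<close> or \<open>B\<close> by a fair coin flip. A variable avoids all constraints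
  of \<open>A\<close> with probability at least \<open>2\<^sup>-\<^sup>r\<close>, and two variables are correlated only if they share a
  constraint; so by a second moment argument some split leaves at least \<open>2\<^sup>-\<^sup>rm - O(\<surd>(rkm))\<close>
  variables untouched by \<open>A\<close>, and as many untouched by \<open>B\<close>. Once the variables common to \<open>A\<close> and
  \<open>B\<close> are queried, the two parts are independent, so one of them is unsatisfiable on its own and
  it suffices to query its remaining variables. Every path has length at most
  \<open>(1 - 2\<^sup>-\<^sup>r)m + o(m)\<close>, and \<open>2\<^sup>-\<^sup>r\<close> is at least the required savings.\<close>

section \<open>Second moment of a random split\<close>

text \<open>Probabilities appear as counts: a sum over \<open>Pow C\<close> is
  \<open>2 ^ card C\<close> times the expectation for a uniform subset of \<open>C\<close>. Such a
  subset misses each element of \<open>T\<close> independently with probability 1/2.\<close>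

lemma sum_Pow_avoid:
  assumes "finite C" "T \<subseteq> C"
  shows "(\<Sum>S\<in>Pow C. of_bool (T \<inter> S = {}) :: real) = 2 ^ card C * (1/2) ^ card T"
proof -
  have fT: "finite T" using assms finite_subset by auto
  have le: "card T \<le> card C" using assms by (simp add: card_mono)
  have "Pow C \<inter> {S. T \<inter> S = {}} = Pow (C - T)" by auto
  then have "(\<Sum>S\<in>Pow C. of_bool (T \<inter> S = {}) :: real) = real (card (Pow (C - T)))"
    using assms by (simp add: Int_def)
  also have "\<dots> = 2 ^ (card C - card T)"
    using assms fT by (simp add: card_Pow card_Diff_subset)
  also have "\<dots> = 2 ^ card C * (1/2) ^ card T"
    using le by (simp add: power_diff power_one_over divide_simps)
  finally show ?thesis .
qed

text \<open>\<open>g x\<close> is the centred indicator of the event that \<open>x\<close> is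
  untouched. For disjoint \<open>E x\<close> and \<open>E y\<close> the two events depend on
  different coins, so the covariance is 0; otherwise the bound
  \<open>\<bar>g z S\<bar> \<le> 1\<close> suffices.\<close>

lemma avoid_covariance:
  fixes E :: "'a \<Rightarrow> 'c set"
  defines "g \<equiv> \<lambda>x S. of_bool (E x \<inter> S = {}) - (1/2 :: real) ^ card (E x)"
  assumes "finite C" "E x \<subseteq> C" "E y \<subseteq> C"
  shows "(\<Sum>S\<in>Pow C. g x S * g y S) \<le> 2 ^ card C * of_bool (E x \<inter> E y \<noteq> {})"
proof (cases "E x \<inter> E y = {}")
  case True
  have fin: "finite (E x)" "finite (E y)" using assms finite_subset by auto
  have prod: "of_bool (E x \<inter> S = {}) * of_bool (E y \<inter> S = {}) = (of_bool ((E x \<union> E y) \<inter> S = {}) :: real)"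
    for S by auto
  have "(\<Sum>S\<in>Pow C. g x S * g y S) =
      (\<Sum>S\<in>Pow C. of_bool ((E x \<union> E y) \<inter> S = {})
         - (1/2) ^ card (E y) * of_bool (E x \<inter> S = {})
         - (1/2) ^ card (E x) * of_bool (E y \<inter> S = {})
         + (1/2) ^ card (E x) * (1/2) ^ card (E y))"
    unfolding g_def prod[symmetric] by (intro sum.cong refl) (simp add: algebra_simps)
  also have "\<dots> = 2 ^ card C * (1/2) ^ card (E x \<union> E y)
         - (1/2) ^ card (E y) * (2 ^ card C * (1/2) ^ card (E x))
         - (1/2) ^ card (E x) * (2 ^ card C * (1/2) ^ card (E y))
         + 2 ^ card C * ((1/2) ^ card (E x) * (1/2) ^ card (E y))"
    using assms
    by (simp only: sum.distrib sum_subtractf sum_distrib_left[symmetric] sum_Pow_avoid Un_subset_iff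
        conj_absorb simp_thms sum_constant card_Pow of_nat_power of_nat_numeral) (simp only: mult_ac)
  \<comment> \<open>Disjointness makes \<open>card (E x \<union> E y)\<close> the sum of the two
    cardinalities, so the four terms are equal up to signs and cancel.\<close>
  also have "\<dots> = 0"
    using True fin by (simp only: card_Un_disjoint power_add) (simp add: algebra_simps)
  finally show ?thesis using True by simp
next
  case False
  have *: "\<bar>g z S\<bar> \<le> 1" for z S
  proof -
    have "(1/2 :: real) ^ card (E z) \<le> 1" "(1/2 :: real) ^ card (E z) \<ge> 0"
      by (auto intro: power_le_one)
    then show ?thesis unfolding g_def by (cases "E z \<inter> S = {}") auto
  qed
  have "g x S * g y S \<le> 1" for S
    using mult_mono[OF *[of x S] *[of y S]] by (simp add: abs_mult[symmetric])
  then have "(\<Sum>S\<in>Pow C. g x S * g y S) \<le> (\<Sum>S\<in>Pow C. 1)"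
    by (intro sum_mono) auto
  then show ?thesis using False assms by (simp add: card_Pow)
qed

text \<open>For fixed \<open>x\<close>, every \<open>y\<close> with \<open>E x\<close> and
  \<open>E y\<close> meeting is found through one of the at most \<open>r\<close> elements of
  \<open>E x\<close>, and each of these lies in at most \<open>k\<close> sets
  \<open>E y\<close>.\<close>

lemma card_pairs_meeting:
  fixes E :: "'a \<Rightarrow> 'c set"
  assumes "finite X" "\<And>x. x \<in> X \<Longrightarrow> finite (E x)" "\<And>x. x \<in> X \<Longrightarrow> card (E x) \<le> r"
    and "\<And>c. card {x \<in> X. c \<in> E x} \<le> k"
  shows "(\<Sum>x\<in>X. \<Sum>y\<in>X. of_bool (E x \<inter> E y \<noteq> {}) :: real) \<le> real (r * k * card X)"
proof -
  have "(\<Sum>y\<in>X. of_bool (E x \<inter> E y \<noteq> {}) :: real) \<le> real (r * k)" if "x \<in> X" for x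
  proof -
    have "X \<inter> {y. E x \<inter> E y \<noteq> {}} = (\<Union>c\<in>E x. {y \<in> X. c \<in> E y})" by auto
    then have "card (X \<inter> {y. E x \<inter> E y \<noteq> {}}) \<le> (\<Sum>c\<in>E x. card {y \<in> X. c \<in> E y})"
      using card_UN_le[of "E x" "\<lambda>c. {y \<in> X. c \<in> E y}"] assms(2)[OF that] by simp
    also have "\<dots> \<le> card (E x) * k"
      using sum_bounded_above[of "E x" "\<lambda>c. card {y \<in> X. c \<in> E y}" k] assms(4) by simp
    also have "\<dots> \<le> r * k" using assms(3)[OF that] by simp
    finally show ?thesis using assms(1) by (simp flip: of_nat_mult)
  qed
  then have "(\<Sum>x\<in>X. \<Sum>y\<in>X. of_bool (E x \<inter> E y \<noteq> {}) :: real) \<le> (\<Sum>x\<in>X. real (r * k))"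
    by (rule sum_mono)
  also have "\<dots> = real (r * k * card X)" by simp
  finally show ?thesis .
qed

text \<open>\<open>w S\<close> is the deviation of the number of untouched elements from its mean.
  Averaging the sum of the squared deviations for \<open>A\<close> and for \<open>C - A\<close>
  yields one \<open>A\<close> that is good for both; this sum is the origin of the factor 2 under
  the root.\<close>

lemma balanced_split:
  fixes E :: "'a \<Rightarrow> 'c set"
  assumes "finite X" "finite C" "\<And>x. x \<in> X \<Longrightarrow> E x \<subseteq> C" "\<And>x. x \<in> X \<Longrightarrow> card (E x) \<le> r"
    and "\<And>c. card {x \<in> X. c \<in> E x} \<le> k"
  obtains A where "A \<subseteq> C"
    and "real (card {x \<in> X. E x \<inter> A = {}}) \<ge> card X / 2 ^ r - sqrt (real (2 * r * k * card X))"
    and "real (card {x \<in> X. E x \<inter> (C - A) = {}}) \<ge> card X / 2 ^ r - sqrt (real (2 * r * k * card X))"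
proof -
  define g where "g = (\<lambda>x S. of_bool (E x \<inter> S = {}) - (1/2 :: real) ^ card (E x))"
  define w where "w = (\<lambda>S. \<Sum>x\<in>X. g x S)"
  have "(\<Sum>S\<in>Pow C. (w S)\<^sup>2) = (\<Sum>S\<in>Pow C. \<Sum>x\<in>X. \<Sum>y\<in>X. g x S * g y S)"
    by (simp add: w_def power2_eq_square sum_product)
  also have "\<dots> = (\<Sum>x\<in>X. \<Sum>y\<in>X. \<Sum>S\<in>Pow C. g x S * g y S)"
    by (subst sum.swap) (intro sum.cong refl sum.swap)
  also have "\<dots> \<le> (\<Sum>x\<in>X. \<Sum>y\<in>X. 2 ^ card C * of_bool (E x \<inter> E y \<noteq> {}))"
    unfolding g_def by (intro sum_mono avoid_covariance assms)
  also have "\<dots> = 2 ^ card C * (\<Sum>x\<in>X. \<Sum>y\<in>X. of_bool (E x \<inter> E y \<noteq> {}))"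
    by (simp add: sum_distrib_left)
  also have "\<dots> \<le> 2 ^ card C * real (r * k * card X)"
    using assms by (intro mult_left_mono card_pairs_meeting) (auto intro: finite_subset)
  finally have var: "(\<Sum>S\<in>Pow C. (w S)\<^sup>2) \<le> 2 ^ card C * real (r * k * card X)" .
  \<comment> \<open>The complement of a uniform subset is again uniform.\<close>
  have compl: "(\<Sum>S\<in>Pow C. (w (C - S))\<^sup>2) = (\<Sum>S\<in>Pow C. (w S)\<^sup>2)"
    by (rule sum.reindex_bij_witness[of _ "\<lambda>S. C - S" "\<lambda>S. C - S"]) (auto simp: double_diff)
  have "\<exists>A\<in>Pow C. (w A)\<^sup>2 + (w (C - A))\<^sup>2 \<le> 2 * real (r * k * card X)"
  proof (rule ccontr)
    assume "\<not> ?thesis"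
    then have "(\<Sum>S\<in>Pow C. 2 * real (r * k * card X)) < (\<Sum>S\<in>Pow C. (w S)\<^sup>2 + (w (C - S))\<^sup>2)"
      using assms(2) by (intro sum_strict_mono) (auto simp: not_le)
    with var compl assms(2) show False by (simp add: sum.distrib card_Pow)
  qed
  then obtain A where A: "A \<subseteq> C" "(w A)\<^sup>2 + (w (C - A))\<^sup>2 \<le> 2 * real (r * k * card X)" by auto
  have untouched: "real (card {x \<in> X. E x \<inter> S = {}}) \<ge> card X / 2 ^ r - sqrt (real (2 * r * k * card X))"
    if "(w S)\<^sup>2 \<le> 2 * real (r * k * card X)" for S
  proof -
    have "\<bar>w S\<bar> \<le> sqrt (real (2 * r * k * card X))"
      using real_sqrt_le_mono[OF that] by (simp add: mult.assoc)
    moreover have "w S = real (card {x \<in> X. E x \<inter> S = {}}) - (\<Sum>x\<in>X. (1/2) ^ card (E x))"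
      using assms(1) by (simp add: w_def g_def sum_subtractf Int_def)
    \<comment> \<open>The mean number of untouched elements is at least
      \<open>card X / 2 ^ r\<close>, since each \<open>E x\<close> has at most \<open>r\<close>
      elements.\<close>
    moreover have "(\<Sum>x\<in>X. (1/2 :: real) ^ r) \<le> (\<Sum>x\<in>X. (1/2) ^ card (E x))"
      using assms(4) by (intro sum_mono power_decreasing) auto
    ultimately show ?thesis by (simp add: power_one_over)
  qed
  have "(w A)\<^sup>2 \<ge> 0" "(w (C - A))\<^sup>2 \<ge> 0" by auto
  with A(2) have "(w A)\<^sup>2 \<le> 2 * real (r * k * card X)" "(w (C - A))\<^sup>2 \<le> 2 * real (r * k * card X)"
    by linarith+
  with A(1) untouched that show thesis by blast
qed

section \<open>Query trees as tree-like resolution\<close>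

lemma falsified_clause_upd:
  assumes "x \<notin> dom \<rho>"
  shows "falsified_clause (\<rho>(x \<mapsto> b)) =
    insert (if b then Neg x else Pos x) (falsified_clause \<rho>)"
  using assms by (auto simp: falsified_clause_def)

lemma falsified_clause_mono:
  "\<sigma> \<subseteq>\<^sub>m \<tau> \<Longrightarrow> falsified_clause \<sigma> \<subseteq> falsified_clause \<tau>"
  by (force simp: falsified_clause_def map_le_def dom_def)

text \<open>Counting \<open>size + 1\<close> makes each query multiply the bound by exactly \<open>2\<close>.\<close>

lemma query_all:
  assumes "finite W" "W \<inter> dom \<rho> = {}"
    and "\<And>\<sigma>. \<rho> \<subseteq>\<^sub>m \<sigma> \<Longrightarrow> dom \<sigma> = dom \<rho> \<union> W \<Longrightarrow>
      \<exists>t. derivation_from F t \<and> conclusion t \<subseteq> falsified_clause \<sigma> \<and> refutation_size t + 1 \<le> s"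
  shows "\<exists>t. derivation_from F t \<and> conclusion t \<subseteq> falsified_clause \<rho> \<and>
    refutation_size t + 1 \<le> 2 ^ card W * s"
  using assms
proof (induction W arbitrary: \<rho> rule: finite_induct)
  case empty
  then show ?case by (auto intro: map_le_refl)
next
  case (insert x W)
  have x: "x \<notin> dom \<rho>" using insert.prems(1) by auto
  have "\<exists>t. derivation_from F t \<and> conclusion t \<subseteq> falsified_clause (\<rho>(x \<mapsto> b)) \<and>
    refutation_size t + 1 \<le> 2 ^ card W * s" for b
  proof (rule insert.IH)
    show "W \<inter> dom (\<rho>(x \<mapsto> b)) = {}" using insert by auto
    fix \<sigma> assume "\<rho>(x \<mapsto> b) \<subseteq>\<^sub>m \<sigma>" "dom \<sigma> = dom (\<rho>(x \<mapsto> b)) \<union> W"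
    moreover have "\<rho> \<subseteq>\<^sub>m \<rho>(x \<mapsto> b)" using x by (auto simp: map_le_def)
    ultimately show "\<exists>t. derivation_from F t \<and> conclusion t \<subseteq> falsified_clause \<sigma> \<and>
        refutation_size t + 1 \<le> s"
      by (intro insert.prems(2)) (auto intro: map_le_trans)
  qed
  from this[of False] this[of True] obtain t0 t1 where
    t0: "derivation_from F t0" "conclusion t0 \<subseteq> insert (Pos x) (falsified_clause \<rho>)"
      "refutation_size t0 + 1 \<le> 2 ^ card W * s"
    and t1: "derivation_from F t1" "conclusion t1 \<subseteq> insert (Neg x) (falsified_clause \<rho>)"
      "refutation_size t1 + 1 \<le> 2 ^ card W * s"
    by (auto simp: falsified_clause_upd[OF x])
  have card: "2 ^ card (insert x W) * s = 2 ^ card W * s + 2 ^ card W * s"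
    using insert by simp
  \<comment> \<open>\<open>Resolve\<close> demands the pivot in both premises. If one premise lacks
    its pivot literal, its conclusion already lies within \<open>falsified_clause \<rho>\<close>,
    and that subtree alone serves.\<close>
  consider "Pos x \<notin> conclusion t0" | "Neg x \<notin> conclusion t1"
    | "Pos x \<in> conclusion t0" "Neg x \<in> conclusion t1" by blast
  then show ?case
  proof cases
    case 1
    with t0 card show ?thesis by (intro exI[of _ t0]) auto
  next
    case 2
    with t1 card show ?thesis by (intro exI[of _ t1]) auto
  next
    case 3
    with t0 t1 card show ?thesis by (intro exI[of _ "Resolve x t0 t1"]) auto
  qed
qed

section \<open>Refutation from a split of the constraints\<close>

definition scope_union :: "'a constraint set \<Rightarrow> 'a set" where
  "scope_union A = (\<Union>c\<in>A. scope c)"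

text \<open>Were both parts satisfiable by extensions of \<open>\<rho>\<close>, these would agree on
  the common variables and glue to a satisfying assignment of \<open>\<Psi>\<close>. The choice of
  \<open>D\<close> depends on \<open>\<rho>\<close> only, so it is known before any further
  query.\<close>

lemma unsat_part_after_common_vars:
  assumes csp: "is_2k_csp k \<Psi>" and unsat: "\<not> csp_satisfiable \<Psi>"
    and split: "A \<union> B = constraints \<Psi>"
    and dom: "dom \<rho> = scope_union A \<inter> scope_union B"
  obtains D where "D \<in> {A, B}"
    and "\<And>\<sigma>. \<rho> \<subseteq>\<^sub>m \<sigma> \<Longrightarrow> dom \<sigma> = scope_union D \<Longrightarrow> \<exists>c\<in>D. \<not> satisfies_constraint \<sigma> c"
proof (rule ccontr)
  assume "\<not> thesis"
  with that obtain \<alpha> \<beta> where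
    \<alpha>: "\<rho> \<subseteq>\<^sub>m \<alpha>" "dom \<alpha> = scope_union A" "\<And>c. c \<in> A \<Longrightarrow> satisfies_constraint \<alpha> c" and
    \<beta>: "\<rho> \<subseteq>\<^sub>m \<beta>" "dom \<beta> = scope_union B" "\<And>c. c \<in> B \<Longrightarrow> satisfies_constraint \<beta> c"
    by (metis insertI1 insertI2)
  \<comment> \<open>The default \<open>True\<close> covers variables in no constraint, because a
    satisfying assignment must have domain exactly \<open>vars \<Psi>\<close>.\<close>
  define \<tau> where "\<tau> = ((\<lambda>x. Some True) |` vars \<Psi>) ++ \<alpha> ++ \<beta>"
  have sub: "scope c \<subseteq> vars \<Psi>" if "c \<in> A \<union> B" for c
    using csp that split by (auto simp: is_2k_csp_def)
  have "dom \<tau> = vars \<Psi>"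
    using sub \<alpha>(2) \<beta>(2) by (auto simp: \<tau>_def scope_union_def)
  moreover have "\<tau> x = \<beta> x" if "x \<in> scope_union B" for x
    using that \<beta>(2) by (auto simp: \<tau>_def map_add_dom_app_simps)
  then have "\<tau> |` scope c = \<beta> |` scope c" if "c \<in> B" for c
    using that by (auto simp: restrict_map_def scope_union_def fun_eq_iff)
  then have "satisfies_constraint \<tau> c" if "c \<in> B" for c
    using \<beta>(3) that by (simp add: satisfies_constraint_def)
  moreover have "\<tau> x = \<alpha> x" if "x \<in> scope_union A" for x
  proof (cases "x \<in> scope_union B")
    case True
    then have "x \<in> dom \<rho>" using that dom by simp
    then have "\<alpha> x = \<beta> x" using \<alpha>(1) \<beta>(1) by (simp add: map_le_def)
    then show ?thesis using True \<beta>(2) by (auto simp: \<tau>_def map_add_dom_app_simps)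
  next
    case False
    then show ?thesis using that \<alpha>(2) \<beta>(2) by (auto simp: \<tau>_def map_add_dom_app_simps)
  qed
  then have "\<tau> |` scope c = \<alpha> |` scope c" if "c \<in> A" for c
    using that by (auto simp: restrict_map_def scope_union_def fun_eq_iff)
  then have "satisfies_constraint \<tau> c" if "c \<in> A" for c
    using \<alpha>(3) that by (simp add: satisfies_constraint_def)
  ultimately show False using unsat split unfolding csp_satisfiable_def by blast
qed

text \<open>The common variables are queried first, then the remaining variables of the part
  \<open>D\<close> selected by the branch. A path thus queries exactly the variables of
  \<open>scope_union D\<close>, at most \<open>d\<close> of them.\<close>

lemma refutation_from_split:
  assumes csp: "is_2k_csp k \<Psi>" and unsat: "\<not> csp_satisfiable \<Psi>"
    and split: "A \<union> B = constraints \<Psi>"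
    and size: "card (scope_union A) \<le> d" "card (scope_union B) \<le> d"
  shows "\<exists>t. tree_refutation (cnf_representation \<Psi>) t \<and> refutation_size t \<le> 2 ^ (d + 1)"
proof -
  let ?F = "cnf_representation \<Psi>" and ?W = "scope_union A \<inter> scope_union B"
  have fin: "finite (scope_union D)" if "D \<subseteq> constraints \<Psi>" for D
    by (rule finite_subset[of _ "vars \<Psi>"]) (use csp that in \<open>auto simp: is_2k_csp_def scope_union_def\<close>)
  have finAB: "finite (scope_union A)" "finite (scope_union B)" using fin split by auto
  have Wd: "card ?W \<le> d" using size(1) finAB by (meson card_mono inf_le1 le_trans)
  \<comment> \<open>The factor \<open>2 ^ (d - card ?W)\<close> pays for the second stage, and the
    final 2 is the size of an axiom plus one. The product does not depend on
    \<open>card ?W\<close>.\<close>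
  have "\<exists>t. derivation_from ?F t \<and> conclusion t \<subseteq> falsified_clause Map.empty \<and>
      refutation_size t + 1 \<le> 2 ^ card ?W * (2 ^ (d - card ?W) * 2)"
  proof (rule query_all)
    fix \<rho> :: "'a assignment" assume "dom \<rho> = dom Map.empty \<union> ?W"
    then have dom: "dom \<rho> = ?W" by simp
    obtain D where D: "D \<in> {A, B}" "\<And>\<sigma>. \<rho> \<subseteq>\<^sub>m \<sigma> \<Longrightarrow> dom \<sigma> = scope_union D \<Longrightarrow>
        \<exists>c\<in>D. \<not> satisfies_constraint \<sigma> c"
      using unsat_part_after_common_vars[OF csp unsat split dom] by metis
    let ?U = "scope_union D - ?W"
    have un: "dom \<rho> \<union> ?U = scope_union D" using D(1) dom by auto
    have "\<exists>t. derivation_from ?F t \<and> conclusion t \<subseteq> falsified_clause \<rho> \<and>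
        refutation_size t + 1 \<le> 2 ^ card ?U * 2"
    proof (rule query_all)
      show "finite ?U" using D(1) finAB by auto
      show "?U \<inter> dom \<rho> = {}" using dom by auto
      fix \<sigma> assume \<sigma>: "\<rho> \<subseteq>\<^sub>m \<sigma>" "dom \<sigma> = dom \<rho> \<union> ?U"
      then obtain c where c: "c \<in> D" "\<not> satisfies_constraint \<sigma> c" using D(2) un by metis
      \<comment> \<open>At a leaf, the restriction of \<open>\<sigma>\<close> to the scope of a
        violated constraint is one of its violating assignments, and the clause of that restriction
        is an axiom.\<close>
      have "scope c \<subseteq> dom \<sigma>" using c(1) \<sigma>(2) un by (auto simp: scope_union_def)
      then have "dom (\<sigma> |` scope c) = scope c" by auto
      moreover have "c \<in> constraints \<Psi>" using c(1) D(1) split by auto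
      ultimately have "falsified_clause (\<sigma> |` scope c) \<in> ?F"
        using c(2) unfolding cnf_representation_def constraint_cnf_def satisfies_constraint_def
        by blast
      moreover have "falsified_clause (\<sigma> |` scope c) \<subseteq> falsified_clause \<sigma>"
        by (intro falsified_clause_mono) (auto simp: map_le_def)
      ultimately show "\<exists>t. derivation_from ?F t \<and> conclusion t \<subseteq> falsified_clause \<sigma> \<and>
          refutation_size t + 1 \<le> 2"
        by (intro exI[of _ "Axiom (falsified_clause (\<sigma> |` scope c))"]) auto
    qed
    moreover have "card ?U = card (scope_union D) - card ?W"
      using D(1) finAB by (intro card_Diff_subset) auto
    then have "card ?U \<le> d - card ?W" using D(1) size by auto
    then have "(2::nat) ^ card ?U * 2 \<le> 2 ^ (d - card ?W) * 2" by simp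
    ultimately show "\<exists>t. derivation_from ?F t \<and> conclusion t \<subseteq> falsified_clause \<rho> \<and>
        refutation_size t + 1 \<le> 2 ^ (d - card ?W) * 2"
      by (meson le_trans)
  qed (use finAB in auto)
  moreover have "falsified_clause Map.empty = {}" by (simp add: falsified_clause_def)
  moreover have "(2::nat) ^ card ?W * (2 ^ (d - card ?W) * 2) = 2 ^ (d + 1)"
    using Wd by (simp flip: power_add)
  ultimately show ?thesis
    unfolding tree_refutation_def by (metis Suc_eq_plus1 Suc_leD subset_empty)
qed

section \<open>The size bound for fixed parameters\<close>

text \<open>A variable lies outside \<open>scope_union S\<close> exactly when none of the
  constraints containing it is in \<open>S\<close>; this turns counts of untouched variables into
  path lengths.\<close>

lemma card_scope_union:
  assumes "is_2k_csp k \<Psi>" "S \<subseteq> constraints \<Psi>"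
  shows "card (scope_union S) =
    card (vars \<Psi>) - card {x \<in> vars \<Psi>. {c \<in> constraints \<Psi>. x \<in> scope c} \<inter> S = {}}"
proof -
  have "scope_union S = vars \<Psi> - {x \<in> vars \<Psi>. {c \<in> constraints \<Psi>. x \<in> scope c} \<inter> S = {}}"
    using assms unfolding is_2k_csp_def scope_union_def by blast
  then show ?thesis
    using assms by (simp add: is_2k_csp_def card_Diff_subset)
qed

lemma card_le_var_frequency:
  assumes "is_2k_csp k \<Psi>" "x \<in> vars \<Psi>"
  shows "card {c \<in> constraints \<Psi>. x \<in> scope c} \<le> var_frequency \<Psi>"
  unfolding var_frequency_def
  using assms by (intro Max_ge) (auto simp: is_2k_csp_def)

text \<open>\<open>balanced_split\<close> is applied with \<open>E x\<close> the set of constraints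
  containing \<open>x\<close>: the frequency bounds the size of \<open>E x\<close> by
  \<open>r\<close>, and the constraint width bounds by \<open>k\<close> how many variables share a
  constraint.\<close>

lemma refutation_bounded_frequency:
  assumes csp: "is_2k_csp k \<Psi>" and unsat: "\<not> csp_satisfiable \<Psi>" and freq: "var_frequency \<Psi> \<le> r"
  defines "m \<equiv> card (vars \<Psi>)"
  shows "\<exists>t. tree_refutation (cnf_representation \<Psi>) t \<and>
    real (refutation_size t) \<le> 2 powr ((1 - 1 / 2 ^ r) * m + (sqrt (real (2 * r * k * m)) + 1))"
proof -
  let ?C = "constraints \<Psi>" and ?E = "\<lambda>x. {c \<in> constraints \<Psi>. x \<in> scope c}"
  have fin: "finite (vars \<Psi>)" "finite ?C" using csp by (auto simp: is_2k_csp_def)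
  have deg: "card (?E x) \<le> r" if "x \<in> vars \<Psi>" for x
    using card_le_var_frequency[OF csp that] freq by simp
  have width: "card {x \<in> vars \<Psi>. c \<in> ?E x} \<le> k" for c
  proof (cases "c \<in> ?C")
    case True
    then have "scope c \<subseteq> vars \<Psi>" "card (scope c) \<le> k" using csp by (auto simp: is_2k_csp_def)
    moreover from this True have "{x \<in> vars \<Psi>. c \<in> ?E x} = scope c" by auto
    ultimately show ?thesis by simp
  qed simp
  obtain A where A: "A \<subseteq> ?C"
    "real (card {x \<in> vars \<Psi>. ?E x \<inter> A = {}}) \<ge> m / 2 ^ r - sqrt (real (2 * r * k * m))"
    "real (card {x \<in> vars \<Psi>. ?E x \<inter> (?C - A) = {}}) \<ge> m / 2 ^ r - sqrt (real (2 * r * k * m))"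
    unfolding m_def by (rule balanced_split[where E = ?E, OF fin _ deg width]) auto
  define d where "d = max (card (scope_union A)) (card (scope_union (?C - A)))"
  have "real (card (scope_union S)) \<le> (1 - 1 / 2 ^ r) * m + sqrt (real (2 * r * k * m))"
    if "S \<subseteq> ?C" "real (card {x \<in> vars \<Psi>. ?E x \<inter> S = {}}) \<ge> m / 2 ^ r - sqrt (real (2 * r * k * m))" for S
  proof -
    have "card {x \<in> vars \<Psi>. ?E x \<inter> S = {}} \<le> m"
      unfolding m_def using fin(1) by (intro card_mono) auto
    with that card_scope_union[OF csp that(1)] show ?thesis
      unfolding m_def[symmetric] by (simp add: of_nat_diff algebra_simps)
  qed
  from this[OF _ A(2)] this[OF _ A(3)] A(1)
  have d: "real d \<le> (1 - 1 / 2 ^ r) * m + sqrt (real (2 * r * k * m))" by (auto simp: d_def max_def)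
  obtain t where t: "tree_refutation (cnf_representation \<Psi>) t" "refutation_size t \<le> 2 ^ (d + 1)"
    using refutation_from_split[OF csp unsat, of A "?C - A" d] A(1) by (auto simp: d_def)
  \<comment> \<open>The summand 1 in the error term comes from the size \<open>2 ^ (d + 1)\<close>
    of a tree of depth \<open>d\<close>.\<close>
  have "real (d + 1) \<le> (1 - 1 / 2 ^ r) * m + (sqrt (real (2 * r * k * m)) + 1)"
    using d by linarith
  then have "2 powr real (d + 1) \<le> 2 powr ((1 - 1 / 2 ^ r) * m + (sqrt (real (2 * r * k * m)) + 1))"
    by (rule powr_mono) simp
  moreover have "real (refutation_size t) \<le> 2 powr real (d + 1)"
    using of_nat_mono[OF t(2), where 'a = real] by (subst powr_realpow) simp_all
  ultimately show ?thesis using t(1) order_trans by blast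
qed

section \<open>Comparison of exponents and asymptotics\<close>

text \<open>As \<open>2 powr (- 1 / real r)\<close> lies between 1/2 and 1, the base of the power in
  \<open>savings r\<close> lies between 0 and 1/2.\<close>

lemma savings_le:
  assumes "r \<ge> 1"
  shows "savings r \<le> 1 / 2 ^ r"
proof -
  have "(2::real) powr (- 1) \<le> 2 powr (- 1 / real r)"
    using assms by (intro powr_mono) (auto simp: field_simps)
  moreover have "(2::real) powr (- 1 / real r) \<le> 2 powr 0"
    by (intro powr_mono) auto
  ultimately have "(1 - 2 powr (- 1 / real r)) ^ r \<le> (1 / 2 :: real) ^ r"
    by (intro power_mono) (auto simp: powr_minus)
  then show ?thesis by (simp add: savings_def power_one_over)
qed

text \<open>Division by \<open>m\<close> turns the left side into
  \<open>sqrt (2 * r * (k m / m)) + 1 / m\<close>, and \<open>k m / m\<close> tends to 0.\<close>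

lemma sqrt_mult_smallo:
  fixes k :: "nat \<Rightarrow> nat"
  assumes "(\<lambda>m. real (k m)) \<in> o(\<lambda>m. sqrt (real m))"
  shows "(\<lambda>m. sqrt (real (2 * r * k m * m)) + 1) \<in> o(\<lambda>m. real m)"
proof -
  have "(\<lambda>m. sqrt (real m)) \<in> O(\<lambda>m. real m)"
    by (intro landau_o.bigI[of 1] eventually_sequentiallyI[of 1])
      (auto intro!: real_le_lsqrt simp: power2_eq_square)
  with assms have "(\<lambda>m. real (k m)) \<in> o(\<lambda>m. real m)"
    by (rule landau_o.small_big_trans)
  then have "(\<lambda>m. k m / m) \<longlonglongrightarrow> 0" by (rule smalloD_tendsto)
  then have "(\<lambda>m. sqrt (2 * r * (k m / m)) + 1 / m) \<longlonglongrightarrow> sqrt (2 * real r * 0) + 0"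
    by (intro tendsto_intros lim_1_over_n) simp_all
  moreover have "\<forall>\<^sub>F m in sequentially. sqrt (2 * r * (k m / m)) + 1 / m =
      (sqrt (real (2 * r * k m * m)) + 1) / real m"
  proof (intro eventually_sequentiallyI[of 1])
    fix m :: nat assume "1 \<le> m"
    then have "2 * r * (k m / m) = 2 * r * k m * m / (real m)\<^sup>2"
      by (simp add: power2_eq_square)
    then show "sqrt (2 * r * (k m / m)) + 1 / m = (sqrt (real (2 * r * k m * m)) + 1) / real m"
      by (simp add: real_sqrt_divide add_divide_distrib)
  qed
  ultimately have "(\<lambda>m. (sqrt (real (2 * r * k m * m)) + 1) / real m) \<longlonglongrightarrow> 0"
    by (simp add: tendsto_cong)
  then show ?thesis
    by (intro smalloI_tendsto eventually_sequentiallyI[of 1]) auto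
qed

theorem theorem5p2:
  fixes r :: nat and k :: "nat \<Rightarrow> nat"
  assumes "r \<ge> 1"
    and "(\<lambda>m. real (k m)) \<in> o(\<lambda>m. sqrt (real m))"
  shows "\<exists>e :: nat \<Rightarrow> real. e \<in> o(\<lambda>m. real m) \<and>
    (\<forall>(m :: nat) (\<Psi> :: 'a csp).
       card (vars \<Psi>) = m \<and> is_2k_csp (k m) \<Psi> \<and> \<not> csp_satisfiable \<Psi> \<and> var_frequency \<Psi> \<le> r \<longrightarrow>
       (\<exists>t. tree_refutation (cnf_representation \<Psi>) t \<and>
            real (refutation_size t) \<le> 2 powr ((1 - savings r) * real m + e m)))"
proof (intro exI[of _ "\<lambda>m. sqrt (real (2 * r * k m * m)) + 1"] conjI allI impI)
  \<comment> \<open>The error term is built from \<open>r\<close> and \<open>k\<close> alone, hence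
    is uniform in \<open>\<Psi>\<close>.\<close>
  show "(\<lambda>m. sqrt (real (2 * r * k m * m)) + 1) \<in> o(\<lambda>m. real m)"
    using assms(2) by (rule sqrt_mult_smallo)
next
  fix m and \<Psi> :: "'a csp"
  assume *: "card (vars \<Psi>) = m \<and> is_2k_csp (k m) \<Psi> \<and> \<not> csp_satisfiable \<Psi> \<and> var_frequency \<Psi> \<le> r"
  then obtain t where t: "tree_refutation (cnf_representation \<Psi>) t"
    "real (refutation_size t) \<le> 2 powr ((1 - 1 / 2 ^ r) * m + (sqrt (real (2 * r * k m * m)) + 1))"
    using refutation_bounded_frequency[of "k m" \<Psi> r] by auto
  have "(1 - 1 / 2 ^ r) * real m \<le> (1 - savings r) * real m"
    using savings_le[OF assms(1)] by (intro mult_right_mono) auto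
  then have "2 powr ((1 - 1 / 2 ^ r) * m + (sqrt (real (2 * r * k m * m)) + 1))
      \<le> 2 powr ((1 - savings r) * m + (sqrt (real (2 * r * k m * m)) + 1))"
    by (intro powr_mono) auto
  with t show "\<exists>t. tree_refutation (cnf_representation \<Psi>) t \<and>
      real (refutation_size t) \<le> 2 powr ((1 - savings r) * m + (sqrt (real (2 * r * k m * m)) + 1))"
    by (meson order_trans)
qed

end
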